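(* Let $X\subset\mathbb{R}^n$ be a Delone set, and let $$c(n)=\frac{\kappa(n)}{\kappa(n)+2},$$ where $\kappa(n)$ is the Delone packing-covering constant in dimension $n$. If there is a single value of $T>0$ such that $$M_X(T) < c(n)\,T,$$ then $X$ has a non-zero period, i.e. there is a non-zero vector $\mathbf{p}\in\mathbb{R}^n$ with $X+\mathbf{p}=X$.
   Context: A Delone set in $\mathbb{R}^n$ is a discrete set $X \subset \mathbb{R}^n$ that is uniformly discrete (its packing radius $r$ by equal balls, i.e. half the infimum of the distances between distinct points of $X$, is positive) and relatively dense (its covering radius $R$, i.e. the smallest radius such that the closed balls of that radius centered at points of $X$ cover $\mathbb{R}^n$, is finite). The packing-covering ratio of $X$ is $\kappa_X=R/r$. The Delone packing-covering constant $\kappa(n)$ is the infimum of $\kappa_X$ over all Delone sets $X$ in $\mathbb{R}^n$. For $\mathbf{x}\in X$ and $T>0$, the $T$-patch of $X$ centered at $\mathbf{x}$ is $\mathcal{P}_X(\mathbf{x};T) = X\cap B(\mathbf{x};T)$, where $B(\mathbf{x};T)$ is the open ball with center $\mathbf{x}$ and radius $T$. Two patches are translation-equivalent, $\mathcal{P}_X(\mathbf{x};T)\sim\mathcal{P}_X(\mathbf{y};T)$, if $\mathcal{P}_X(\mathbf{y};T)=\mathcal{P}_X(\mathbf{x};T)+\mathbf{y}-\mathbf{x}$. The repetitivity function $M_X(T)$ is the least $M$ (possibly infinite) such that every closed ball of radius $M$ contains the center of a $T$-patch of every kind that occurs in $X$; that is, for every $\mathbf{x}\in X$, every closed ball of radius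 $M$ in $\mathbb{R}^n$ contains a point $\mathbf{y}\in X$ with $\mathcal{P}_X(\mathbf{y};T)\sim\mathcal{P}_X(\mathbf{x};T)$ (the patch itself may extend outside the ball). *)

theory Defs
  imports "HOL-Analysis.Analysis"
begin

(* Radii, ratios and the repetitivity function take values in ereal, so that the infimum of the
   empty set is \<infinity> (a set with at most one point has packing radius \<infinity>). *)

definition packing_radius :: "(real ^ 'n::finite) set \<Rightarrow> ereal" where
  "packing_radius X = Inf {ereal (dist x y) | x y. x \<in> X \<and> y \<in> X \<and> x \<noteq> y} / 2"

(* For the locally finite sets considered here this infimum is attained whenever it is finite,
   so it is the smallest covering radius.  Negative R are excluded automatically, as their closed
   balls are empty.  The same two remarks apply to repetitivity below. *)
definition covering_radius :: "(real ^ 'n::finite) set \<Rightarrow> ereal" where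
  "covering_radius X = Inf {ereal R | R. (\<Union>x\<in>X. cball x R) = UNIV}"

(* Positive packing radius already implies discreteness. *)
definition Delone_set :: "(real ^ 'n::finite) set \<Rightarrow> bool" where
  "Delone_set X \<longleftrightarrow> 0 < packing_radius X \<and> covering_radius X < \<infinity>"

definition packing_covering_ratio :: "(real ^ 'n::finite) set \<Rightarrow> ereal" where
  "packing_covering_ratio X = covering_radius X / packing_radius X"

(* The constant kappa(n) for n = CARD('n). *)
definition packing_covering_constant :: "'n::finite itself \<Rightarrow> ereal" where
  "packing_covering_constant _ =
     Inf {packing_covering_ratio X | X :: (real ^ 'n) set. Delone_set X}"

definition patch :: "(real ^ 'n::finite) set \<Rightarrow> real ^ 'n \<Rightarrow> real \<Rightarrow> (real ^ 'n) set" where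
  "patch X x T = X \<inter> ball x T"

definition patch_equiv :: "(real ^ 'n::finite) set \<Rightarrow> real \<Rightarrow> real ^ 'n \<Rightarrow> real ^ 'n \<Rightarrow> bool" where
  "patch_equiv X T x y \<longleftrightarrow> patch X y T = (\<lambda>z. z + (y - x)) ` patch X x T"

definition repetitivity :: "(real ^ 'n::finite) set \<Rightarrow> real \<Rightarrow> ereal" where
  "repetitivity X T =
     Inf {ereal M | M. \<forall>x\<in>X. \<forall>z. \<exists>y \<in> X \<inter> cball z M. patch_equiv X T x y}"

definition c_const :: "'n::finite itself \<Rightarrow> ereal" where
  "c_const n = packing_covering_constant n / (packing_covering_constant n + 2)"

end

theory Submission
  imports Defs
begin

text \<open>
  Fix a point \<open>x\<close> of \<open>X\<close> and a real \<open>M < c(n) T\<close> such that the centres of patches equivalent to the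
  \<open>T\<close>-patch at \<open>x\<close> meet every closed ball of radius \<open>M\<close>.  These centres form a set \<open>Y\<close> of covering
  radius at most \<open>M\<close>.  By the definition of \<open>\<kappa>(n)\<close> such a set cannot be too sparse: its points cannot
  all be at mutual distance at least \<open>d\<close> unless \<open>\<kappa>(n) \<le> 2 M / d\<close>
  (\<open>packing_covering_constant_le\<close>).  The bound \<open>M < c(n) T\<close> says precisely that this fails for
  \<open>d = T - M\<close>, so \<open>Y\<close> has two distinct points whose difference \<open>p\<close> satisfies \<open>M + \<bar>p\<bar> < T\<close>.

  The two patches at these points are translates of each other by \<open>p\<close>, so \<open>p\<close> is a period of \<open>X\<close>
  inside the patch.  The patch being the same around every point of \<open>Y\<close>, the vector \<open>p\<close> acts as a
  period inside the ball of radius \<open>T\<close> around every point of \<open>Y\<close> (\<open>patch_equiv_local_period\<close>).  An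
  arbitrary point \<open>w\<close> lies within \<open>M\<close> of some \<open>y \<in> Y\<close>, and then \<open>w\<close> and \<open>w + p\<close> both lie in the ball
  around \<open>y\<close>; hence \<open>w \<in> X \<longleftrightarrow> w + p \<in> X\<close> everywhere.
\<close>

lemma covering_radius_le:
  assumes "\<And>z. \<exists>y\<in>Y. dist z y \<le> M"
  shows "covering_radius Y \<le> ereal M"
proof -
  have "(\<Union>y\<in>Y. cball y M) = UNIV"
    using assms by (auto simp: dist_commute)
  then show ?thesis
    unfolding covering_radius_def by (intro Inf_lower) blast
qed

lemma covering_radius_nonneg: "0 \<le> covering_radius Y"
  unfolding covering_radius_def
proof (rule Inf_greatest, clarify)
  fix R assume "(\<Union>y\<in>Y. cball y R) = UNIV"
  then have "0 \<in> (\<Union>y\<in>Y. cball y R)" by simp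
  then obtain y where "y \<in> Y" "0 \<in> cball y R" by blast
  then have "0 \<le> R" using zero_le_dist order_trans unfolding mem_cball by blast
  then show "0 \<le> ereal R" by simp
qed

lemma packing_radius_ge:
  assumes "\<And>x y. x \<in> Y \<Longrightarrow> y \<in> Y \<Longrightarrow> x \<noteq> y \<Longrightarrow> d \<le> dist x y"
  shows "ereal (d / 2) \<le> packing_radius Y"
proof -
  have "ereal d \<le> Inf {ereal (dist x y) | x y. x \<in> Y \<and> y \<in> Y \<and> x \<noteq> y}"
    using assms by (intro Inf_greatest) auto
  then have "ereal d / 2 \<le> packing_radius Y"
    unfolding packing_radius_def by (intro ereal_divide_right_mono) auto
  then show ?thesis by simp
qed

lemma packing_covering_constant_nonneg:
  "0 \<le> packing_covering_constant TYPE('n::finite)"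
  unfolding packing_covering_constant_def packing_covering_ratio_def Delone_set_def
  by (rule Inf_greatest) (auto intro!: zero_le_divide_ereal covering_radius_nonneg)

text \<open>
  Since \<open>\<kappa>(n)\<close> is an infimum over all Delone sets, it bounds how well any one set can be separated
  relative to its covering radius.  Here \<open>Y\<close> is Delone with covering radius at most \<open>M\<close> and packing
  radius at least \<open>d / 2\<close>.
\<close>

lemma packing_covering_constant_le:
  fixes Y :: "(real ^ 'n::finite) set"
  assumes "0 < d"
    and cover: "\<And>z. \<exists>y\<in>Y. dist z y \<le> M"
    and sep: "\<And>x y. x \<in> Y \<Longrightarrow> y \<in> Y \<Longrightarrow> x \<noteq> y \<Longrightarrow> d \<le> dist x y"
  shows "packing_covering_constant TYPE('n) \<le> ereal (2 * M / d)"
proof -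
  have cov: "covering_radius Y \<le> ereal M"
    using cover by (rule covering_radius_le)
  have pack: "ereal (d / 2) \<le> packing_radius Y"
    using sep by (rule packing_radius_ge)
  have pos: "0 < ereal (d / 2)"
    using \<open>0 < d\<close> by simp
  have "0 \<le> ereal M"
    using covering_radius_nonneg cov by (rule order_trans)
  have "Delone_set Y"
    unfolding Delone_set_def using less_le_trans[OF pos pack] cov by auto
  then have "packing_covering_constant TYPE('n) \<le> covering_radius Y / packing_radius Y"
    unfolding packing_covering_constant_def packing_covering_ratio_def
    by (intro Inf_lower) blast
  also have "\<dots> \<le> ereal M / packing_radius Y"
    using cov less_le_trans[OF pos pack] by (intro ereal_divide_right_mono)
  also have "\<dots> \<le> ereal M / ereal (d / 2)"
    unfolding divide_ereal_def
    using pack \<open>0 \<le> ereal M\<close> pos by (intro ereal_mult_left_mono ereal_inverse_antimono) auto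
  also have "\<dots> = ereal (2 * M / d)"
    using \<open>0 < d\<close> by (simp add: field_simps)
  finally show ?thesis .
qed

lemma patch_equivD:
  assumes "patch_equiv X T x y" and "norm v < T"
  shows "x + v \<in> X \<longleftrightarrow> y + v \<in> X"
proof -
  have "y + v \<in> patch X y T \<longleftrightarrow> y + v \<in> (\<lambda>z. z + (y - x)) ` patch X x T"
    using assms(1) by (simp add: patch_equiv_def)
  also have "\<dots> \<longleftrightarrow> x + v \<in> patch X x T"
    by (force simp: image_iff algebra_simps)
  finally show ?thesis
    using assms(2) by (simp add: patch_def dist_norm)
qed

text \<open>
  A vector joining two occurrences of a patch is a period inside the patch, at every occurrence:
  writing \<open>w = y + v\<close>, the positions \<open>v\<close> and \<open>v + p\<close> in the patch at \<open>y\<close> correspond to \<open>b + v\<close>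
  and \<open>a + v + p = b + v\<close> in the patches at \<open>b\<close> and \<open>a\<close>.
\<close>

lemma patch_equiv_local_period:
  assumes a: "patch_equiv X T x a" and b: "patch_equiv X T x b" and y: "patch_equiv X T x y"
    and w: "dist w y < T" "dist (w + (b - a)) y < T"
  shows "w \<in> X \<longleftrightarrow> w + (b - a) \<in> X"
proof -
  define v where "v = w - y"
  have v: "norm v < T" "norm (v + (b - a)) < T"
    using w by (simp_all add: v_def dist_norm algebra_simps)
  have "w \<in> X \<longleftrightarrow> x + v \<in> X"
    using patch_equivD[OF y v(1)] by (simp add: v_def)
  also have "\<dots> \<longleftrightarrow> b + v \<in> X"
    using b v(1) by (rule patch_equivD)
  also have "\<dots> \<longleftrightarrow> x + (v + (b - a)) \<in> X"
    using patch_equivD[OF a v(2)] by (simp add: algebra_simps)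
  also have "\<dots> \<longleftrightarrow> w + (b - a) \<in> X"
    using patch_equivD[OF y v(2)] by (simp add: v_def algebra_simps)
  finally show ?thesis .
qed

theorem theorem2p3:
  fixes X :: "(real ^ 'n::finite) set" and T :: real
  assumes "Delone_set X"
    and "T > 0"
    and "repetitivity X T < c_const TYPE('n) * ereal T"
  shows "\<exists>p :: real ^ 'n. p \<noteq> 0 \<and> (\<lambda>x. x + p) ` X = X"
proof -
  obtain x where "x \<in> X"
  proof -
    have "X \<noteq> {}"
      using assms(1) by (auto simp: Delone_set_def covering_radius_def top_ereal_def)
    then show ?thesis using that by blast
  qed
  obtain M where M: "ereal M < c_const TYPE('n) * ereal T"
    and rep: "\<forall>x\<in>X. \<forall>z. \<exists>y \<in> X \<inter> cball z M. patch_equiv X T x y"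
    using assms(3) unfolding repetitivity_def Inf_less_iff by blast
  define Y where "Y = {y \<in> X. patch_equiv X T x y}"
  have cover: "\<exists>y\<in>Y. dist z y \<le> M" for z
    using rep \<open>x \<in> X\<close> unfolding Y_def by fastforce
  have "0 \<le> M"
    using cover[of 0] zero_le_dist order_trans by blast

  \<comment> \<open>If \<open>\<kappa>(n) = \<infinity>\<close>, then \<open>c(n)\<close> would be \<open>\<infinity> / \<infinity>\<close>, which is \<open>0\<close> in \<^typ>\<open>ereal\<close>, against
    \<open>0 \<le> M < c(n) T\<close>.\<close>
  obtain k where k: "packing_covering_constant TYPE('n) = ereal k" and "0 \<le> k"
    using packing_covering_constant_nonneg[where 'n = 'n] M \<open>0 \<le> M\<close>
    by (cases "packing_covering_constant TYPE('n)") (auto simp: c_const_def)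
  have M_less: "M < k / (k + 2) * T"
    using M k \<open>0 \<le> k\<close> by (simp add: c_const_def)
  then have bound: "M * (k + 2) < k * T"
    using \<open>0 \<le> k\<close> by (simp add: field_simps)
  have "k * T \<le> (k + 2) * T"
    using \<open>T > 0\<close> by simp
  then have "M * (k + 2) < T * (k + 2)"
    using bound by (simp add: mult.commute)
  then have "M < T"
    using \<open>0 \<le> k\<close> by (simp add: mult_less_cancel_right)

  have "\<exists>a\<in>Y. \<exists>b\<in>Y. a \<noteq> b \<and> dist a b < T - M"
  proof (rule ccontr)
    assume "\<not> ?thesis"
    then have "T - M \<le> dist a b" if "a \<in> Y" "b \<in> Y" "a \<noteq> b" for a b
      using that not_le by blast
    then have "packing_covering_constant TYPE('n) \<le> ereal (2 * M / (T - M))"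
      using \<open>M < T\<close> cover by (intro packing_covering_constant_le) auto
    then have "k * (T - M) \<le> 2 * M"
      using \<open>M < T\<close> k by (simp add: field_simps)
    then show False
      using bound by (simp add: algebra_simps)
  qed
  then obtain a b where ab: "a \<in> Y" "b \<in> Y" "a \<noteq> b" and close: "dist a b < T - M"
    by blast
  define p where "p = b - a"
  have period: "w \<in> X \<longleftrightarrow> w + p \<in> X" for w
  proof -
    obtain y where y: "y \<in> Y" "dist w y \<le> M"
      using cover by blast
    have "dist (w + p) y \<le> dist w y + norm p"
      using norm_triangle_ineq[of "w - y" p] by (simp add: dist_norm algebra_simps)
    also have "\<dots> < T"
      using y(2) close by (simp add: p_def dist_norm norm_minus_commute)
    finally show ?thesis
      using patch_equiv_local_period[of X T x a b y w] ab y \<open>M < T\<close> by (simp add: Y_def p_def)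
  qed
  have "(\<lambda>x. x + p) ` X = X"
  proof
    show "(\<lambda>x. x + p) ` X \<subseteq> X"
      using period by blast
    show "X \<subseteq> (\<lambda>x. x + p) ` X"
    proof
      fix w assume "w \<in> X"
      then have "w - p \<in> X" using period[of "w - p"] by simp
      then show "w \<in> (\<lambda>x. x + p) ` X" by (intro image_eqI[of _ _ "w - p"]) auto
    qed
  qed
  moreover have "p \<noteq> 0"
    using ab by (simp add: p_def)
  ultimately show ?thesis by blast
qed

end
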